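(* Let $(\Sigma,I)$ be a trace alphabet, let $\varphi$ be a formula of $\mathrm{LTL}(\Sigma,I)$, and let $u\in\Sigma^\ast$. Then for every $v\in\Sigma^\ast$ with $v\approx u$ (i.e. every $v\in[u]_{\approx}$), $$[u\models^{t}\varphi]=[v\models^{t}\varphi].$$
   Context: **Trace alphabet.** A trace alphabet is a pair $(\Sigma,I)$ where $\Sigma$ is a finite non-empty set and $I\subseteq\Sigma\times\Sigma$ is irreflexive and symmetric (independence). Put $D=(\Sigma\times\Sigma)\setminus I$ (dependency). $\Sigma^\infty=\Sigma^\ast\cup\Sigma^\omega$ is the set of finite and infinite words. **Traces.** A trace over $(\Sigma,I)$ is a $\Sigma$-labelled poset $T=(E,\leq,\lambda)$, $\lambda:E\to\Sigma$, such that: (i) ${\downarrow}e=\{x\in E\mid x\le e\}$ is finite for every $e\in E$; (ii) if $e'$ covers $e$ (i.e. $e<e'$ and nothing lies strictly between), then $(\lambda(e),\lambda(e'))\in D$; (iii) if $(\lambda(e),\lambda(e'))\in D$ then $e\le e'$ or $e'\le e$. Isomorphic traces are identified. **Configurations.** A configuration of $T$ is a finite set $c\subseteq E$ that is downward closed. $\mathcal C_T$ is the set of configurations. For $c,c'\in\mathcal C_T$ and $a\in\Sigma$, $c\xrightarrow{a}_T c'$ means there is $e\in E\setminus c$ with $\lambda(e)=a$ and $c'=c\cup\{e\}$. **Linearisations and equivalence.** $w\in\Sigma^\infty$ is a linearisation of $T$ iff there is a map $\rho$ from the finite prefixes of $w$ to $\mathcal C_T$ with $\rho(\varepsilon)=\emptyset$,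 $\rho(v)\xrightarrow{a}_T\rho(va)$ for each finite prefix $va$ of $w$, and every $e\in E$ belongs to $\rho(u)$ for some finite prefix $u$ of $w$. For $w,w'\in\Sigma^\infty$, $w\approx w'$ iff $w{\upharpoonright}p=w'{\upharpoonright}p$ for every $p\subseteq\Sigma$ with $p\times p\subseteq D$, where $w{\upharpoonright}p$ erases from $w$ all letters not in $p$. The equivalence class of $w$ is $[w]_\approx$. For $w\in\Sigma^\infty$, $T_w$ is the unique (up to isomorphism) trace having $w$ as a linearisation; its set of linearisations is $[w]_\approx$. (Concretely: events are the positions of $w$, labelled by their letters, and $\le$ is the reflexive-transitive closure of $\{(i,j)\mid i<j,\ (w_i,w_j)\in D\}$.) **Logic.** Formulas of $\mathrm{LTL}(\Sigma,I)$ (also called LTrL) are given by $\varphi::=\mathrm{tt}\mid\neg\varphi\mid\varphi\vee\psi\mid\langle a\rangle\varphi\mid\varphi\,\mathcal U\,\psi$ with $a\in\Sigma$. For a trace $T$ and $c\in\mathcal C_T$: $T,c\models\mathrm{tt}$ always; $\neg,\vee$ are interpreted as usual; $T,c\models\langle a\rangle\varphi$ iff there is $c'\in\mathcal C_T$ with $c\xrightarrow{a}_T c'$ and $T,c'\models\varphi$; $T,c\models\varphi\,\mathcal U\,\psi$ iff there is $c'\in\mathcal C_T$ with $c\subseteq c'$, $T,c'\models\psi$, and $T,c''\models\varphi$ for all $c''\in\mathcal C_T$ with $c\subseteq c''\subsetneq c'$. $T\models\varphi$ means $T,\emptyset\models\varphi$. **Three-valued semantics.** For $u\in\Sigma^\ast$,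 the value $[u\models^{t}\varphi]\in\{\bot,?,\top\}$ is $\top$ if $T_{u\sigma}\models\varphi$ for all $\sigma\in\Sigma^\omega$; $\bot$ if $T_{u\sigma}\not\models\varphi$ for all $\sigma\in\Sigma^\omega$; and $?$ otherwise. *)

theory Defs
  imports "HOL-Library.Omega_Words_Fun"
begin

locale trace_alphabet =
  fixes \<Sigma> :: "'a set" and I :: "('a \<times> 'a) set"
  assumes finite_alphabet: "finite \<Sigma>"
    and nonempty_alphabet: "\<Sigma> \<noteq> {}"
    and indep_subset: "I \<subseteq> \<Sigma> \<times> \<Sigma>"
    and indep_irrefl: "irrefl I"
    and indep_sym: "sym I"

definition dep :: "'a set \<Rightarrow> ('a \<times> 'a) set \<Rightarrow> ('a \<times> 'a) set" where
  "dep \<Sigma> I = (\<Sigma> \<times> \<Sigma>) - I"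


subsection \<open>Finite and infinite words\<close>

datatype 'a finf_word = Fin "'a list" | Inf "'a word"

definition omega_words :: "'a set \<Rightarrow> 'a word set" where
  "omega_words \<Sigma> = {\<sigma>. range \<sigma> \<subseteq> \<Sigma>}"

definition finf_words :: "'a set \<Rightarrow> 'a finf_word set" where
  "finf_words \<Sigma> = Fin ` lists \<Sigma> \<union> Inf ` omega_words \<Sigma>"

fun positions :: "'a finf_word \<Rightarrow> nat set" where
  "positions (Fin u) = {..<length u}"
| "positions (Inf \<sigma>) = UNIV"

fun letter :: "'a finf_word \<Rightarrow> nat \<Rightarrow> 'a" where
  "letter (Fin u) i = u ! i"
| "letter (Inf \<sigma>) i = \<sigma> i"

fun finite_prefixes :: "'a finf_word \<Rightarrow> 'a list set" where
  "finite_prefixes (Fin u) = {take n u | n. True}"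
| "finite_prefixes (Inf \<sigma>) = {prefix n \<sigma> | n. True}"

text \<open>
  Erasing the letters outside \<open>p\<close> from an infinite word yields a finite word
  if only finitely many of its letters lie in \<open>p\<close>.
\<close>
fun restrict_word :: "'a finf_word \<Rightarrow> 'a set \<Rightarrow> 'a finf_word" where
  "restrict_word (Fin u) p = Fin (filter (\<lambda>x. x \<in> p) u)"
| "restrict_word (Inf \<sigma>) p =
    (let N = {i. \<sigma> i \<in> p} in
     if finite N then Fin (map \<sigma> (sorted_list_of_set N))
     else Inf (\<lambda>n. \<sigma> (enumerate N n)))"

definition word_equiv ::
    "'a set \<Rightarrow> ('a \<times> 'a) set \<Rightarrow> 'a finf_word \<Rightarrow> 'a finf_word \<Rightarrow> bool" where
  "word_equiv \<Sigma> I w w' \<longleftrightarrow>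
    (\<forall>p. p \<subseteq> \<Sigma> \<and> p \<times> p \<subseteq> dep \<Sigma> I \<longrightarrow> restrict_word w p = restrict_word w' p)"


subsection \<open>Traces, configurations and linearisations\<close>

record ('e, 'a) labelled_poset =
  events :: "'e set"
  le :: "('e \<times> 'e) set"
  lab :: "'e \<Rightarrow> 'a"

definition covers :: "('e, 'a) labelled_poset \<Rightarrow> 'e \<Rightarrow> 'e \<Rightarrow> bool" where
  "covers T e e' \<longleftrightarrow> (e, e') \<in> le T \<and> e \<noteq> e' \<and>
    (\<forall>x. (e, x) \<in> le T \<and> (x, e') \<in> le T \<longrightarrow> x = e \<or> x = e')"

definition is_trace ::
    "'a set \<Rightarrow> ('a \<times> 'a) set \<Rightarrow> ('e, 'a) labelled_poset \<Rightarrow> bool" where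
  "is_trace \<Sigma> I T \<longleftrightarrow>
    partial_order_on (events T) (le T) \<and>
    lab T ` events T \<subseteq> \<Sigma> \<and>
    (\<forall>e\<in>events T. finite {x \<in> events T. (x, e) \<in> le T}) \<and>
    (\<forall>e\<in>events T. \<forall>e'\<in>events T. covers T e e' \<longrightarrow> (lab T e, lab T e') \<in> dep \<Sigma> I) \<and>
    (\<forall>e\<in>events T. \<forall>e'\<in>events T. (lab T e, lab T e') \<in> dep \<Sigma> I \<longrightarrow>
      (e, e') \<in> le T \<or> (e', e) \<in> le T)"

definition configs :: "('e, 'a) labelled_poset \<Rightarrow> 'e set set" where
  "configs T = {c. finite c \<and> c \<subseteq> events T \<and>
    (\<forall>e\<in>c. \<forall>x\<in>events T. (x, e) \<in> le T \<longrightarrow> x \<in> c)}"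

definition step :: "('e, 'a) labelled_poset \<Rightarrow> 'e set \<Rightarrow> 'a \<Rightarrow> 'e set \<Rightarrow> bool" where
  "step T c a c' \<longleftrightarrow> c \<in> configs T \<and> c' \<in> configs T \<and>
    (\<exists>e\<in>events T - c. lab T e = a \<and> c' = c \<union> {e})"

definition linearisation :: "('e, 'a) labelled_poset \<Rightarrow> 'a finf_word \<Rightarrow> bool" where
  "linearisation T w \<longleftrightarrow> (\<exists>\<rho>.
    (\<forall>v\<in>finite_prefixes w. \<rho> v \<in> configs T) \<and>
    \<rho> [] = {} \<and>
    (\<forall>v a. v @ [a] \<in> finite_prefixes w \<longrightarrow> step T (\<rho> v) a (\<rho> (v @ [a]))) \<and>
    (\<forall>e\<in>events T. \<exists>u\<in>finite_prefixes w. e \<in> \<rho> u))"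

text \<open>
  The concrete representative of the trace, unique up to isomorphism, that has \<open>w\<close> as a
  linearisation.  The intersection only discards the reflexive pairs that the closure
  adds outside the set of positions.
\<close>
definition trace_of ::
    "'a set \<Rightarrow> ('a \<times> 'a) set \<Rightarrow> 'a finf_word \<Rightarrow> (nat, 'a) labelled_poset" where
  "trace_of \<Sigma> I w = \<lparr>
    events = positions w,
    le = {(i, j). i \<in> positions w \<and> j \<in> positions w \<and> i < j \<and>
            (letter w i, letter w j) \<in> dep \<Sigma> I}\<^sup>* \<inter> (positions w \<times> positions w),
    lab = letter w\<rparr>"


subsection \<open>The logic and its three-valued semantics\<close>

datatype (letters: 'a) ltrl =
    TT
  | Neg "'a ltrl"
  | Or "'a ltrl" "'a ltrl"
  | Dia 'a "'a ltrl"
  | Until "'a ltrl" "'a ltrl"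

definition ltrl_formulas :: "'a set \<Rightarrow> 'a ltrl set" where
  "ltrl_formulas \<Sigma> = {\<phi>. letters \<phi> \<subseteq> \<Sigma>}"

primrec sat :: "('e, 'a) labelled_poset \<Rightarrow> 'e set \<Rightarrow> 'a ltrl \<Rightarrow> bool" where
  "sat T c TT \<longleftrightarrow> True"
| "sat T c (Neg \<phi>) \<longleftrightarrow> \<not> sat T c \<phi>"
| "sat T c (Or \<phi> \<psi>) \<longleftrightarrow> sat T c \<phi> \<or> sat T c \<psi>"
| "sat T c (Dia a \<phi>) \<longleftrightarrow> (\<exists>c'\<in>configs T. step T c a c' \<and> sat T c' \<phi>)"
| "sat T c (Until \<phi> \<psi>) \<longleftrightarrow> (\<exists>c'\<in>configs T. c \<subseteq> c' \<and> sat T c' \<psi> \<and>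
     (\<forall>c''\<in>configs T. c \<subseteq> c'' \<and> c'' \<subset> c' \<longrightarrow> sat T c'' \<phi>))"

definition models :: "('e, 'a) labelled_poset \<Rightarrow> 'a ltrl \<Rightarrow> bool" where
  "models T \<phi> \<longleftrightarrow> sat T {} \<phi>"

datatype verdict = Bottom | Unknown | Top

text \<open>
  Over a non-empty alphabet the first two cases exclude each other, so their order is
  immaterial.
\<close>
definition verdict_of ::
    "'a set \<Rightarrow> ('a \<times> 'a) set \<Rightarrow> 'a list \<Rightarrow> 'a ltrl \<Rightarrow> verdict" where
  "verdict_of \<Sigma> I u \<phi> =
    (if \<forall>\<sigma>\<in>omega_words \<Sigma>. models (trace_of \<Sigma> I (Inf (u \<frown> \<sigma>))) \<phi> then Top
     else if \<forall>\<sigma>\<in>omega_words \<Sigma>. \<not> models (trace_of \<Sigma> I (Inf (u \<frown> \<sigma>))) \<phi> then Bottom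
     else Unknown)"


subsection \<open>Adequacy of the concrete trace of a word\<close>

lemma trace_of_simps [simp]:
  "events (trace_of \<Sigma> I w) = positions w"
  "lab (trace_of \<Sigma> I w) = letter w"
  by (simp_all add: trace_of_def)

lemma le_trace_ofD: "(i, j) \<in> le (trace_of \<Sigma> I w) \<Longrightarrow> i \<le> j \<and> i \<in> positions w \<and> j \<in> positions w"
proof -
  let ?r = "{(i, j). i \<in> positions w \<and> j \<in> positions w \<and> i < j \<and>
      (letter w i, letter w j) \<in> dep \<Sigma> I}"
  have "(i, j) \<in> ?r\<^sup>* \<Longrightarrow> i \<le> j" by (induction rule: rtrancl_induct) auto
  then show "(i, j) \<in> le (trace_of \<Sigma> I w) \<Longrightarrow> i \<le> j \<and> i \<in> positions w \<and> j \<in> positions w"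
    by (auto simp: trace_of_def)
qed

lemma letter_in_alphabet:
  "w \<in> finf_words \<Sigma> \<Longrightarrow> i \<in> positions w \<Longrightarrow> letter w i \<in> \<Sigma>"
  by (auto simp: finf_words_def omega_words_def in_lists_conv_set)

lemma is_trace_trace_of:
  assumes "trace_alphabet \<Sigma> I" and w: "w \<in> finf_words \<Sigma>"
  shows "is_trace \<Sigma> I (trace_of \<Sigma> I w)"
proof -
  interpret trace_alphabet \<Sigma> I by fact
  let ?T = "trace_of \<Sigma> I w" and ?P = "positions w"
  define r where "r = {(i, j). i \<in> ?P \<and> j \<in> ?P \<and> i < j \<and> (letter w i, letter w j) \<in> dep \<Sigma> I}"
  have le: "le ?T = r\<^sup>* \<inter> (?P \<times> ?P)" by (simp add: trace_of_def r_def)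
  have po: "partial_order_on ?P (le ?T)"
    unfolding partial_order_on_def preorder_on_def
  proof (intro conjI)
    show "antisym (le ?T)" by (meson antisymI le_trace_ofD order_antisym)
    show "trans (le ?T)" unfolding le by (auto intro!: transI)
  qed (auto simp: le refl_on_def)
  have fin: "finite {x \<in> ?P. (x, e) \<in> le ?T}" for e
    by (rule finite_subset[of _ "{..e}"]) (auto dest: le_trace_ofD)
  have cov: "(letter w i, letter w j) \<in> dep \<Sigma> I" if c: "covers ?T i j" for i j
  proof -
    have "(i, j) \<in> r\<^sup>*" "i \<noteq> j" using c by (auto simp: covers_def le)
    then obtain k where k: "(i, k) \<in> r" "(k, j) \<in> r\<^sup>*" by (meson converse_rtranclE)
    have "j \<in> ?P" using c by (auto simp: covers_def le)
    with k have "(i, k) \<in> le ?T" "(k, j) \<in> le ?T" by (auto simp: le r_def)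
    with c have "k = i \<or> k = j" by (auto simp: covers_def)
    with k(1) show ?thesis by (auto simp: r_def)
  qed
  have tot: "(i, j) \<in> le ?T \<or> (j, i) \<in> le ?T"
    if P: "i \<in> ?P" "j \<in> ?P" and d: "(letter w i, letter w j) \<in> dep \<Sigma> I" for i j
  proof -
    have d': "(letter w j, letter w i) \<in> dep \<Sigma> I"
      using d indep_sym by (auto simp: dep_def sym_def)
    consider "i < j" | "i = j" | "j < i" by linarith
    then show ?thesis
    proof cases
      case 1 then have "(i, j) \<in> r" using P d by (simp add: r_def)
      then show ?thesis using P by (auto simp: le)
    next
      case 2 then show ?thesis using P by (auto simp: le)
    next
      case 3 then have "(j, i) \<in> r" using P d' by (simp add: r_def)
      then show ?thesis using P by (auto simp: le)
    qed
  qed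
  show ?thesis
    unfolding is_trace_def
    using po fin cov tot letter_in_alphabet[OF w] by auto
qed

lemma linearisation_trace_of: "linearisation (trace_of \<Sigma> I w) w"
proof -
  let ?T = "trace_of \<Sigma> I w"
  define \<rho> where "\<rho> v = {..<length v}" for v :: "'a list"
  have sub: "{..<length v} \<subseteq> positions w" if "v \<in> finite_prefixes w" for v
    using that by (cases w) auto
  have conf: "{..<n} \<in> configs ?T" if "{..<n} \<subseteq> positions w" for n
    using that by (force simp: configs_def dest: le_trace_ofD)
  have last: "letter w (length v) = a" if p: "v @ [a] \<in> finite_prefixes w" for v a
  proof (cases w)
    case (Fin u)
    then obtain n where n: "v @ [a] = take n u" using p Fin by auto
    then have "length v < n" "length v < length u"
      by (metis length_append_singleton length_take lessI min_less_iff_conj)+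
    then show ?thesis using Fin n by (metis letter.simps(1) nth_append_length nth_take)
  next
    case (Inf \<sigma>)
    then obtain n where n: "v @ [a] = prefix n \<sigma>" using p Inf by auto
    then have "length v < n"
      by (metis diff_zero length_append_singleton lessI subsequence_length)
    then show ?thesis using Inf n
      by (metis add_0 diff_zero letter.simps(2) nth_append_length subsequence_nth)
  qed
  have st: "step ?T (\<rho> v) a (\<rho> (v @ [a]))" if p: "v @ [a] \<in> finite_prefixes w" for v a
  proof -
    have s: "{..<Suc (length v)} \<subseteq> positions w" using sub[OF p] by simp
    then have "{..<length v} \<subseteq> positions w" "length v \<in> positions w" by auto
    with s show ?thesis
      using conf[OF s] conf[of "length v"] last[OF p]
      by (auto simp: step_def \<rho>_def lessThan_Suc)
  qed
  have cover: "\<exists>u\<in>finite_prefixes w. e \<in> \<rho> u" if "e \<in> positions w" for e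
  proof (cases w)
    case (Fin u)
    then have "u \<in> finite_prefixes w" by (auto intro!: exI[of _ "length u"])
    with that Fin show ?thesis by (intro bexI[of _ u]) (auto simp: \<rho>_def)
  next
    case (Inf \<sigma>)
    then have "prefix (Suc e) \<sigma> \<in> finite_prefixes w"
      unfolding Inf finite_prefixes.simps by blast
    then show ?thesis by (rule bexI[rotated]) (simp add: \<rho>_def)
  qed
  show ?thesis unfolding linearisation_def
    using conf sub st cover by (intro exI[of _ \<rho>]) (simp add: \<rho>_def)
qed

end

theory Submission
  imports Defs "HOL-Combinatorics.Transposition"
begin

text \<open>
  If \<open>v = a v'\<close> and \<open>u \<approx> v\<close>, the first \<open>a\<close> in \<open>u\<close> is preceded only by letters independent of it,
  so adjacent independent letters can be swapped until \<open>a\<close> comes first; by induction \<open>u\<close> is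
  transformed into \<open>v\<close>. Each swap leaves the trace of \<open>u\<sigma>\<close> unchanged up to isomorphism, and
  satisfaction is invariant under isomorphism.
\<close>

subsection \<open>Isomorphisms of labelled posets\<close>

definition poset_iso ::
    "('e \<Rightarrow> 'f) \<Rightarrow> ('e, 'a) labelled_poset \<Rightarrow> ('f, 'a) labelled_poset \<Rightarrow> bool" where
  "poset_iso f T T' \<longleftrightarrow> bij_betw f (events T) (events T') \<and>
    (\<forall>e\<in>events T. lab T' (f e) = lab T e) \<and>
    (\<forall>e\<in>events T. \<forall>e'\<in>events T. (f e, f e') \<in> le T' \<longleftrightarrow> (e, e') \<in> le T)"

lemma poset_iso_image_configs_iff:
  assumes "poset_iso f T T'" and "c \<subseteq> events T"
  shows "f ` c \<in> configs T' \<longleftrightarrow> c \<in> configs T"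
proof -
  have ev: "events T' = f ` events T" and inj: "inj_on f (events T)"
    and le: "\<forall>e\<in>events T. \<forall>e'\<in>events T. (f e, f e') \<in> le T' \<longleftrightarrow> (e, e') \<in> le T"
    using assms(1) by (auto simp: poset_iso_def bij_betw_def)
  have "finite (f ` c) \<longleftrightarrow> finite c"
    using inj assms(2) by (meson finite_image_iff inj_on_subset)
  moreover have "f x \<in> f ` c \<longleftrightarrow> x \<in> c" if "x \<in> events T" for x
    using inj assms(2) that by (meson inj_on_image_mem_iff)
  ultimately show ?thesis
    using assms(2) le unfolding configs_def ev by (auto simp: subset_iff)
qed

lemma poset_iso_configs:
  assumes "poset_iso f T T'"
  shows "configs T' = image f ` configs T"
proof (intro equalityI subsetI)
  fix d assume d: "d \<in> configs T'"
  then have "d \<subseteq> f ` events T"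
    using assms by (auto simp: configs_def poset_iso_def bij_betw_def)
  then obtain c where c: "c \<subseteq> events T" "d = f ` c" by (auto simp: subset_image_iff)
  with d poset_iso_image_configs_iff[OF assms c(1)] show "d \<in> image f ` configs T" by auto
next
  fix d assume "d \<in> image f ` configs T"
  then obtain c where c: "c \<in> configs T" "d = f ` c" by auto
  then have "c \<subseteq> events T" by (simp add: configs_def)
  with c poset_iso_image_configs_iff[OF assms] show "d \<in> configs T'" by auto
qed

lemma poset_iso_image_subset_iff:
  assumes "poset_iso f T T'" "c \<in> configs T" "d \<in> configs T"
  shows "f ` c \<subseteq> f ` d \<longleftrightarrow> c \<subseteq> d"
proof -
  have "inj_on f (events T)" "c \<subseteq> events T" "d \<subseteq> events T"
    using assms by (auto simp: poset_iso_def bij_betw_def configs_def)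
  then show ?thesis unfolding inj_on_def by blast
qed

lemma poset_iso_image_psubset_iff:
  assumes "poset_iso f T T'" "c \<in> configs T" "d \<in> configs T"
  shows "f ` c \<subset> f ` d \<longleftrightarrow> c \<subset> d"
  using assms by (simp add: less_le_not_le poset_iso_image_subset_iff)

lemma poset_iso_step_iff:
  assumes "poset_iso f T T'" "c \<in> configs T" "d \<in> configs T"
  shows "step T' (f ` c) a (f ` d) \<longleftrightarrow> step T c a d"
proof -
  have ev: "events T' = f ` events T" and inj: "inj_on f (events T)"
    and lab: "\<forall>e\<in>events T. lab T' (f e) = lab T e"
    using assms(1) by (auto simp: poset_iso_def bij_betw_def)
  have sub: "c \<subseteq> events T" "d \<subseteq> events T" using assms by (auto simp: configs_def)
  have conf: "f ` c \<in> configs T'" "f ` d \<in> configs T'"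
    using assms by (auto simp: poset_iso_configs)
  have diff: "events T' - f ` c = f ` (events T - c)"
    using inj sub by (simp add: ev inj_on_image_set_diff)
  have "f ` d = f ` c \<union> {f e} \<longleftrightarrow> d = c \<union> {e}" if "e \<in> events T" for e
    using inj_on_image_eq_iff[OF inj, of d "c \<union> {e}"] sub that by auto
  with lab assms(2,3) conf show ?thesis
    unfolding step_def diff by auto
qed

text \<open>The modalities quantify only over configurations, and by
  \<open>poset_iso_configs\<close> those of \<open>T'\<close> are exactly the images of those of
  \<open>T\<close>. Steps and inclusions between images are both preserved and reflected, so each
  quantifier transfers and the induction hypothesis applies to arbitrary \<open>c\<close>.\<close>

lemma poset_iso_sat_iff:
  assumes "poset_iso f T T'" and "c \<in> configs T"
  shows "sat T' (f ` c) \<phi> \<longleftrightarrow> sat T c \<phi>"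
  using assms(2)
proof (induction \<phi> arbitrary: c)
  case (Dia a \<phi>)
  then show ?case
    by (simp add: poset_iso_configs[OF assms(1)] poset_iso_step_iff[OF assms(1)])
next
  case (Until \<phi> \<psi>)
  then show ?case
    by (simp add: poset_iso_configs[OF assms(1)] poset_iso_image_subset_iff[OF assms(1)]
        poset_iso_image_psubset_iff[OF assms(1)] cong: conj_cong)
qed simp_all

lemma poset_iso_models_iff:
  assumes "poset_iso f T T'"
  shows "models T' \<phi> \<longleftrightarrow> models T \<phi>"
  using poset_iso_sat_iff[OF assms, of "{}"] by (simp add: models_def configs_def)


subsection \<open>Rearranging infinite words\<close>

text \<open>Order preservation is asked only for dependent pairs and only in one direction, which
  keeps witnesses easy to check and to compose. For symmetric \<open>D\<close>, reflection follows;
  see \<open>word_iso_poset_iso\<close>.\<close>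

definition word_iso :: "('a \<times> 'a) set \<Rightarrow> 'a word \<Rightarrow> 'a word \<Rightarrow> bool" where
  "word_iso D w w' \<longleftrightarrow> (\<exists>f. bij f \<and> (\<forall>i. w' (f i) = w i) \<and>
    (\<forall>i j. i < j \<longrightarrow> (w i, w j) \<in> D \<longrightarrow> f i < f j))"

lemma word_isoI:
  assumes "bij f" "\<And>i. w' (f i) = w i" "\<And>i j. i < j \<Longrightarrow> (w i, w j) \<in> D \<Longrightarrow> f i < f j"
  shows "word_iso D w w'"
  using assms unfolding word_iso_def by blast

lemma word_iso_refl: "word_iso D w w"
  by (rule word_isoI[of id]) auto

lemma word_iso_trans:
  assumes "word_iso D w w'" "word_iso D w' w''"
  shows "word_iso D w w''"
proof -
  obtain f g where "bij f" "\<forall>i. w' (f i) = w i"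
      "\<forall>i j. i < j \<longrightarrow> (w i, w j) \<in> D \<longrightarrow> f i < f j"
    and "bij g" "\<forall>i. w'' (g i) = w' i"
      "\<forall>i j. i < j \<longrightarrow> (w' i, w' j) \<in> D \<longrightarrow> g i < g j"
    using assms unfolding word_iso_def by blast
  then show ?thesis by (intro word_isoI[of "g \<circ> f"]) (auto intro: bij_comp)
qed

lemma word_iso_build:
  assumes "word_iso D w w'"
  shows "word_iso D (a ## w) (a ## w')"
proof -
  obtain f where f: "bij f" "\<forall>i. w' (f i) = w i"
      "\<forall>i j. i < j \<longrightarrow> (w i, w j) \<in> D \<longrightarrow> f i < f j"
    using assms unfolding word_iso_def by blast
  \<comment> \<open>The new first position is fixed, so it still precedes all others; the remaining
    positions follow \<open>f\<close>, shifted by one.\<close>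
  let ?g = "case_nat 0 (Suc \<circ> f)"
  show ?thesis
  proof (rule word_isoI)
    have "inj ?g"
      using f(1) by (auto simp: inj_def bij_def split: nat.splits)
    moreover have "\<exists>i. n = ?g i" for n
    proof (cases n)
      case 0
      then show ?thesis by (intro exI[of _ 0]) simp
    next
      case (Suc m)
      moreover obtain i where "m = f i" using f(1) by (meson bij_pointE)
      ultimately show ?thesis by (intro exI[of _ "Suc i"]) simp
    qed
    ultimately show "bij ?g" by (auto simp: bij_def surj_def)
  next
    show "(a ## w') (?g i) = (a ## w) i" for i
      using f(2) by (cases i) simp_all
  next
    show "?g i < ?g j" if "i < j" "((a ## w) i, (a ## w) j) \<in> D" for i j
      using that f(3) by (cases i; cases j) simp_all
  qed
qed

text \<open>The transposition of positions 0 and 1 reverses the order of this one pair only, and its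
  labels \<open>(a, b)\<close> are not in \<open>D\<close>.\<close>

lemma word_iso_swap:
  assumes "(a, b) \<notin> D"
  shows "word_iso D (a ## b ## w) (b ## a ## w)"
proof (rule word_isoI)
  let ?f = "Transposition.transpose 0 (Suc 0)"
  let ?w = "a ## b ## w"
  have f_SS: "?f (Suc (Suc i)) = Suc (Suc i)" for i by (simp add: transpose_def)
  have split: "i = 0 \<or> i = Suc 0 \<or> (\<exists>k. i = Suc (Suc k))" for i
    by (metis not0_implies_Suc)
  show "bij ?f" by simp
  show "(b ## a ## w) (?f i) = ?w i" for i
    using split[of i] by (auto simp: f_SS)
  show "?f i < ?f j" if "i < j" "(?w i, ?w j) \<in> D" for i j
    using that split[of i] split[of j] assms by (auto simp: f_SS)
qed

lemma word_iso_move_front: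
  assumes "\<forall>b\<in>set x. (b, a) \<notin> D"
  shows "word_iso D (x \<frown> (a ## w)) (a ## (x \<frown> w))"
  using assms
proof (induction x)
  case Nil
  then show ?case by (simp add: word_iso_refl)
next
  case (Cons b x)
  \<comment> \<open>The letter \<open>a\<close> first passes the tail \<open>x\<close> underneath
    \<open>b\<close>, then \<open>b\<close> itself.\<close>
  then have "word_iso D (b ## (x \<frown> (a ## w))) (b ## a ## (x \<frown> w))"
    by (intro word_iso_build) simp
  also have "word_iso D (b ## a ## (x \<frown> w)) (a ## b ## (x \<frown> w))"
    using Cons.prems by (intro word_iso_swap) simp
  finally (word_iso_trans) show ?case by simp
qed

lemma rtrancl_image:
  assumes "\<And>x y. (x, y) \<in> r \<Longrightarrow> (f x, f y) \<in> s" and "(x, y) \<in> r\<^sup>*"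
  shows "(f x, f y) \<in> s\<^sup>*"
  using assms(2) by induction (auto intro: assms(1) rtrancl_into_rtrancl)

lemma word_iso_poset_iso:
  assumes "sym (dep \<Sigma> I)" and "word_iso (dep \<Sigma> I) w w'"
  obtains f where "poset_iso f (trace_of \<Sigma> I (Inf w)) (trace_of \<Sigma> I (Inf w'))"
proof -
  let ?D = "dep \<Sigma> I"
  obtain f where f: "bij f" "\<forall>i. w' (f i) = w i"
      "\<forall>i j. i < j \<longrightarrow> (w i, w j) \<in> ?D \<longrightarrow> f i < f j"
    using assms unfolding word_iso_def by blast
  define r where "r = {(i, j). i < j \<and> (w i, w j) \<in> ?D}"
  define r' where "r' = {(i, j). i < j \<and> (w' i, w' j) \<in> ?D}"
  have r_iff: "(f i, f j) \<in> r' \<longleftrightarrow> (i, j) \<in> r" for i j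
  proof -
    \<comment> \<open>Otherwise \<open>j < i\<close>, and by symmetry of the dependency
      \<open>f\<close> would have to keep this pair in order, giving
      \<open>f j < f i\<close>.\<close>
    have "i < j" if "f i < f j" "(w i, w j) \<in> ?D"
    proof (rule ccontr)
      assume "\<not> i < j"
      moreover have "i \<noteq> j" using that(1) by auto
      moreover have "(w j, w i) \<in> ?D" using assms(1) that(2) by (auto dest: symD)
      ultimately have "f j < f i" using f(3) by (meson linorder_neqE_nat)
      with that(1) show False by simp
    qed
    then show ?thesis using f(2,3) by (auto simp: r_def r'_def)
  qed
  have "(f i, f j) \<in> r'\<^sup>* \<longleftrightarrow> (i, j) \<in> r\<^sup>*" for i j
  proof
    \<comment> \<open>Surjectivity matters here: the intermediate points of an
      \<open>r'\<close>-path must be images under \<open>f\<close> for the path to be pulled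
      back.\<close>
    have "(inv f x, inv f y) \<in> r" if "(x, y) \<in> r'" for x y
      using that r_iff[of "inv f x" "inv f y"] f(1) by (simp add: bij_is_surj surj_f_inv_f)
    moreover assume "(f i, f j) \<in> r'\<^sup>*"
    ultimately have "(inv f (f i), inv f (f j)) \<in> r\<^sup>*" by (rule rtrancl_image)
    then show "(i, j) \<in> r\<^sup>*" using f(1) by (simp add: bij_is_inj)
  next
    show "(i, j) \<in> r\<^sup>* \<Longrightarrow> (f i, f j) \<in> r'\<^sup>*" using r_iff by (blast intro: rtrancl_image)
  qed
  \<comment> \<open>Every natural number is a position of an infinite word, so the two trace orders
    are exactly the closures of \<open>r\<close> and \<open>r'\<close>.\<close>
  then have "poset_iso f (trace_of \<Sigma> I (Inf w)) (trace_of \<Sigma> I (Inf w'))"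
    using f(1,2) by (simp add: poset_iso_def trace_of_def r_def r'_def)
  then show thesis by (rule that)
qed


subsection \<open>Equivalent finite words\<close>

lemma (in trace_alphabet) sym_dep: "sym (dep \<Sigma> I)"
  using indep_sym by (auto simp: dep_def sym_def)

lemma (in trace_alphabet) dep_refl: "a \<in> \<Sigma> \<Longrightarrow> (a, a) \<in> dep \<Sigma> I"
  using indep_irrefl by (auto simp: dep_def irrefl_def)

lemma word_equiv_Fin_iff:
  "word_equiv \<Sigma> I (Fin u) (Fin v) \<longleftrightarrow>
    (\<forall>p. p \<subseteq> \<Sigma> \<longrightarrow> p \<times> p \<subseteq> dep \<Sigma> I \<longrightarrow> filter (\<lambda>x. x \<in> p) u = filter (\<lambda>x. x \<in> p) v)"
  by (auto simp: word_equiv_def)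

lemma (in trace_alphabet) word_equiv_set_eq:
  assumes "word_equiv \<Sigma> I (Fin u) (Fin v)" "u \<in> lists \<Sigma>" "v \<in> lists \<Sigma>"
  shows "set u = set v"
proof -
  have "a \<in> set u \<longleftrightarrow> a \<in> set v" if "a \<in> \<Sigma>" for a
  proof -
    \<comment> \<open>Since \<open>a\<close> depends on itself, \<open>{a}\<close> is an admissible
      choice of \<open>p\<close>.\<close>
    have "filter (\<lambda>x. x \<in> {a}) u = filter (\<lambda>x. x \<in> {a}) v"
      using assms(1) that dep_refl unfolding word_equiv_Fin_iff by blast
    then have "set (filter (\<lambda>x. x \<in> {a}) u) = set (filter (\<lambda>x. x \<in> {a}) v)" by simp
    then show ?thesis by auto
  qed
  then show ?thesis using assms(2,3) by (auto simp: in_lists_conv_set)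
qed

text \<open>If \<open>b\<close> depended on \<open>a\<close>, then \<open>{a, b}\<close> would be an
  admissible \<open>p\<close>. The projection of \<open>a # v\<close> starts with \<open>a\<close>,
  while that of \<open>x @ y\<close> starts with a letter of \<open>x\<close>, because
  \<open>b\<close> survives in \<open>x\<close>; this would put \<open>a\<close> into
  \<open>x\<close>.\<close>

lemma (in trace_alphabet) word_equiv_indep_prefix:
  assumes eq: "word_equiv \<Sigma> I (Fin (x @ y)) (Fin (a # v))"
    and a: "a \<in> \<Sigma>" "a \<notin> set x" and b: "b \<in> set x"
  shows "(b, a) \<notin> dep \<Sigma> I"
proof
  assume ba: "(b, a) \<in> dep \<Sigma> I"
  then have "b \<in> \<Sigma>" by (simp add: dep_def)
  with ba a(1) have "{a, b} \<subseteq> \<Sigma>" "{a, b} \<times> {a, b} \<subseteq> dep \<Sigma> I"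
    using dep_refl sym_dep by (auto dest: symD)
  then have "filter (\<lambda>z. z \<in> {a, b}) (x @ y) = filter (\<lambda>z. z \<in> {a, b}) (a # v)"
    using eq by (simp only: word_equiv_Fin_iff)
  then have *: "filter (\<lambda>z. z \<in> {a, b}) x @ filter (\<lambda>z. z \<in> {a, b}) y
      = a # filter (\<lambda>z. z \<in> {a, b}) v" by simp
  have "filter (\<lambda>z. z \<in> {a, b}) x \<noteq> []" using b by (auto simp: filter_empty_conv)
  with * have "a \<in> set (filter (\<lambda>z. z \<in> {a, b}) x)"
    unfolding append_eq_Cons_conv by (metis list.set_intros(1))
  with a(2) show False by simp
qed

text \<open>If \<open>a\<close> lies in \<open>p\<close>, all letters of \<open>p\<close> depend on
  \<open>a\<close>, so none occurs in \<open>x\<close>; both projections then start with this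
  \<open>a\<close>, which cancels. If not, the projections never see it.\<close>

lemma (in trace_alphabet) word_equiv_remove_first:
  assumes eq: "word_equiv \<Sigma> I (Fin (x @ a # y)) (Fin (a # v))"
    and a: "a \<in> \<Sigma>" "a \<notin> set x"
  shows "word_equiv \<Sigma> I (Fin (x @ y)) (Fin v)"
  unfolding word_equiv_Fin_iff
proof (intro allI impI)
  fix p assume p: "p \<subseteq> \<Sigma>" "p \<times> p \<subseteq> dep \<Sigma> I"
  then have f: "filter (\<lambda>z. z \<in> p) (x @ a # y) = filter (\<lambda>z. z \<in> p) (a # v)"
    using eq by (simp only: word_equiv_Fin_iff)
  show "filter (\<lambda>z. z \<in> p) (x @ y) = filter (\<lambda>z. z \<in> p) v"
  proof (cases "a \<in> p")
    case True
    then have "filter (\<lambda>z. z \<in> p) x = []"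
      using p(2) word_equiv_indep_prefix[OF eq a] by (auto simp: filter_empty_conv)
    with True f show ?thesis by simp
  next
    case False
    with f show ?thesis by simp
  qed
qed

lemma (in trace_alphabet) word_equiv_word_iso:
  assumes "word_equiv \<Sigma> I (Fin u) (Fin v)" "u \<in> lists \<Sigma>" "v \<in> lists \<Sigma>"
  shows "word_iso (dep \<Sigma> I) (u \<frown> \<sigma>) (v \<frown> \<sigma>)"
  using assms
proof (induction v arbitrary: u)
  case Nil
  then have "u = []" using word_equiv_set_eq[OF Nil.prems] by simp
  then show ?case by (simp add: word_iso_refl)
next
  case (Cons a v)
  have a: "a \<in> \<Sigma>" using Cons.prems(3) by simp
  have "a \<in> set u" using word_equiv_set_eq[OF Cons.prems] by simp
  \<comment> \<open>Splitting at the first occurrence keeps \<open>a\<close> out of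
    \<open>x\<close>, as both preceding lemmas require. The induction hypothesis is then used for
    \<open>x @ y\<close> in place of \<open>u\<close>.\<close>
  then obtain x y where u: "u = x @ a # y" and x: "a \<notin> set x"
    by (meson split_list_first)
  have eq: "word_equiv \<Sigma> I (Fin (x @ a # y)) (Fin (a # v))" using Cons.prems(1) u by simp
  have "word_iso (dep \<Sigma> I) (x \<frown> (a ## (y \<frown> \<sigma>))) (a ## (x \<frown> (y \<frown> \<sigma>)))"
    using word_equiv_indep_prefix[OF eq a x] by (intro word_iso_move_front) blast
  also have "word_iso (dep \<Sigma> I) (a ## (x \<frown> (y \<frown> \<sigma>))) (a ## (v \<frown> \<sigma>))"
    using Cons.IH[OF word_equiv_remove_first[OF eq a x]] Cons.prems(2,3) u
    by (intro word_iso_build) simp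
  finally (word_iso_trans) show ?case by (simp add: u)
qed

theorem theorem3:
  fixes \<Sigma> :: "'a set" and I :: "('a \<times> 'a) set" and \<phi> :: "'a ltrl" and u :: "'a list"
  assumes "trace_alphabet \<Sigma> I"
    and "\<phi> \<in> ltrl_formulas \<Sigma>"
    and "u \<in> lists \<Sigma>"
  shows "\<forall>v \<in> lists \<Sigma>. word_equiv \<Sigma> I (Fin v) (Fin u) \<longrightarrow>
           verdict_of \<Sigma> I u \<phi> = verdict_of \<Sigma> I v \<phi>"
proof (intro ballI impI)
  interpret trace_alphabet \<Sigma> I by fact
  fix v assume v: "v \<in> lists \<Sigma>" "word_equiv \<Sigma> I (Fin v) (Fin u)"
  \<comment> \<open>Both words receive the same continuation, so the conditions in
    \<open>verdict_of\<close> agree pointwise in \<open>\<sigma>\<close>.\<close>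
  have "models (trace_of \<Sigma> I (Inf (u \<frown> \<sigma>))) \<phi> \<longleftrightarrow> models (trace_of \<Sigma> I (Inf (v \<frown> \<sigma>))) \<phi>" for \<sigma>
    using word_iso_poset_iso[OF sym_dep word_equiv_word_iso[OF v(2,1) assms(3)]]
      poset_iso_models_iff by metis
  then show "verdict_of \<Sigma> I u \<phi> = verdict_of \<Sigma> I v \<phi>"
    by (simp add: verdict_of_def)
qed

end
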